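(* Let $B_{n,k}$ be the external profile of a random symmetric digital search tree of size $n$. For large $n$ and $0\le k\le n$ (with $k=k(n)$ allowed to depend on $n$), $\mathbb{E}(B_{n,k})\to\infty$ if and only if $\mathrm{Var}(B_{n,k})\to\infty$. In fact, $\mathbb{E}(B_{n,k})$ and $\mathrm{Var}(B_{n,k})$ are of the same order of magnitude in this range (that is, where they tend to infinity).
   Context: Random symmetric digital search tree (DST) of size $n$: one is given a sequence of $n$ records, each an infinite string of bits, all bits of all records being independent and uniform on $\{0,1\}$. If $n=0$ the tree is a single external node. If $n\ge1$, the first record is stored in the root (an internal node, at level $0$); the remaining $n-1$ records are distributed, retaining their relative order, to the left or right subtree according as their first bit is $0$ or $1$; the subtrees are built recursively by the same rule, using the next bit at each level. Thus the tree is a binary tree with $n$ internal nodes (holding the records) and $n+1$ external nodes (empty places). External profile: $B_{n,k}$ is the number of external nodes at level (distance from the root) $k$. Equivalently, $B_{0,0}=1$, $B_{0,k}=0$ for $k\ge1$, $B_{n,0}=0$ for $n\ge1$, and for $n,k\ge1$, $B_{n,k}\stackrel{d}{=}B_{J_n,k-1}+B^*_{n-1-J_n,k-1}$, where $J_n$ is Binomial$(n-1,\frac12)$, and $B^*$ is an independent copy of $B$ (both independent of $J_n$). "Of the same order of magnitude" means that the ratio is bounded above and below by positive constants. *)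

theory Defs
  imports "HOL-Probability.Probability" "HOL-Library.Tree"
begin

text \<open>A leaf is an external node. The first argument of \<open>dst\<close> is the level of the root,
  i.e. the position of the bit that directs a record to the left (0) or right (1) subtree.\<close>

fun dst :: "nat \<Rightarrow> bool stream list \<Rightarrow> bool stream tree" where
  "dst d [] = Leaf"
| "dst d (r # rs) =
     Node (dst (Suc d) (filter (\<lambda>s. \<not> s !! d) rs)) r (dst (Suc d) (filter (\<lambda>s. s !! d) rs))"

fun external_nodes_at :: "'a tree \<Rightarrow> nat \<Rightarrow> nat" where
  "external_nodes_at Leaf k = (if k = 0 then 1 else 0)"
| "external_nodes_at (Node l x r) 0 = 0"
| "external_nodes_at (Node l x r) (Suc k) = external_nodes_at l k + external_nodes_at r k"

text \<open>Infinitely many records, with all bits independent and uniform; the tree of size \<open>n\<close> uses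
  the first \<open>n\<close> of them.\<close>

definition random_records :: "bool stream stream measure" where
  "random_records = stream_space (stream_space (measure_pmf (pmf_of_set UNIV)))"

definition external_profile :: "nat \<Rightarrow> nat \<Rightarrow> bool stream stream \<Rightarrow> real" where
  "external_profile n k \<omega> = real (external_nodes_at (dst 0 (stake n \<omega>)) k)"

definition mean_profile :: "nat \<Rightarrow> nat \<Rightarrow> real" where
  "mean_profile n k = prob_space.expectation random_records (external_profile n k)"

definition var_profile :: "nat \<Rightarrow> nat \<Rightarrow> real" where
  "var_profile n k = prob_space.variance random_records (external_profile n k)"

end

theory Submission imports Defs begin

text \<open>The recursive structure of the tree gives, for the variance, the recurrence of the mean plus
  a toll: if the \<open>n\<close> records below the root split into \<open>i\<close> and \<open>j\<close>, then \<open>V(n + 1, k + 1)\<close> is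
  the average of \<open>V(i, k) + V(j, k)\<close> plus the variance of \<open>M(i, k) + M(j, k)\<close> over the random
  split, where \<open>M\<close> is the mean and \<open>V\<close> the variance of the profile. Both bounds are inductions
  on the level: if \<open>V\<close> is compared with \<open>M\<close> on level \<open>k\<close>, then the same comparison holds on
  level \<open>k + 1\<close>, up to the toll. They hold for every tree size and not only asymptotically.

  For the lower bound the toll is dropped, so it suffices to find a level on which the
  variance is at least a constant times the mean for all tree sizes. Level 3 is the first such
  level (\<open>var_profile_3_ge\<close>, \<open>var_profile_ge\<close>). As level \<open>k\<close> has at most \<open>2 ^ k\<close> nodes, a
  mean above 4 forces \<open>k \<ge> 3\<close>.

  For the upper bound the toll on level \<open>k + 1\<close> must be at most \<open>\<delta> k\<close> times the mean with a
  summable sequence \<open>\<delta>\<close> (\<open>split_variance_mean_profile_le\<close>, \<open>var_profile_le\<close>). Since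
  \<open>M(i, k) + M(j, k)\<close> is symmetric in the two subtrees, its variance is governed by the second
  difference of \<open>M\<close> in the number of records: this is the Efron--Stein inequality, applied
  twice (\<open>split_variance_symmetric_le\<close>). A difference in the number of records expresses \<open>M\<close>
  through neighbouring levels with an additional factor \<open>1 / 2 ^ k\<close> (\<open>mean_profile_Suc_left\<close>),
  but adjacent levels may have means of very different size. They are compared by
  \<open>path_prob_le_descend\<close>: up to the factor \<open>k + 1\<close>, multiplication by \<open>n / 2 ^ k\<close> costs one
  level. Together the two facts give \<open>\<delta> k\<close> of order \<open>k\<^sup>2 / 2 ^ k\<close>.\<close>

section \<open>The profile on a finite probability space\<close>

lemma measurable_map_stake:
  fixes f :: "'a \<Rightarrow> 'b::countable"
  assumes [measurable]: "f \<in> M \<rightarrow>\<^sub>M count_space UNIV"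
  shows "(\<lambda>\<omega>. map f (stake n \<omega>)) \<in> stream_space M \<rightarrow>\<^sub>M count_space UNIV"
proof -
  have "(\<lambda>\<omega>. stake n (smap f \<omega>)) \<in> stream_space M \<rightarrow>\<^sub>M count_space UNIV"
    by measurable
  then show ?thesis by simp
qed

text \<open>Records matter only through finitely many bits, so the profile can be studied on a finite
  probability space: this lemma pushes the stream measure forward, and it is applied twice,
  once to the bits of a record and once to the sequence of records.\<close>

lemma distr_map_stake:
  fixes f :: "'a \<Rightarrow> 'b::countable"
  assumes M: "prob_space M" and f[measurable]: "f \<in> M \<rightarrow>\<^sub>M count_space UNIV"
    and distr: "distr M (count_space UNIV) f = measure_pmf p"
  shows "distr (stream_space M) (count_space UNIV) (\<lambda>\<omega>. map f (stake n \<omega>)) =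
    measure_pmf (replicate_pmf n p)"
proof -
  interpret prob_space M by fact
  interpret S: prob_space "stream_space M" by (rule prob_space_stream_space)
  note [measurable] = measurable_map_stake[OF f]
  have nn: "(\<integral>\<^sup>+\<omega>. g (map f (stake n \<omega>)) \<partial>stream_space M) = (\<integral>\<^sup>+xs. g xs \<partial>replicate_pmf n p)"
    for g :: "'b list \<Rightarrow> ennreal"
  proof (induction n arbitrary: g)
    case 0
    show ?case using S.emeasure_space_1 by simp
  next
    case (Suc n)
    have "(\<integral>\<^sup>+\<omega>. g (map f (stake (Suc n) \<omega>)) \<partial>stream_space M) =
        (\<integral>\<^sup>+x. \<integral>\<^sup>+\<omega>. g (f x # map f (stake n \<omega>)) \<partial>stream_space M \<partial>M)"
      by (subst nn_integral_stream_space) (auto intro!: measurable_compose[OF measurable_map_stake[OF f]])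
    also have "\<dots> = (\<integral>\<^sup>+x. (\<integral>\<^sup>+xs. g (f x # xs) \<partial>replicate_pmf n p) \<partial>M)"
      by (intro nn_integral_cong) (rule Suc.IH)
    also have "\<dots> = (\<integral>\<^sup>+y. (\<integral>\<^sup>+xs. g (y # xs) \<partial>replicate_pmf n p) \<partial>distr M (count_space UNIV) f)"
      by (subst nn_integral_distr) auto
    also have "\<dots> = (\<integral>\<^sup>+xs. g xs \<partial>replicate_pmf (Suc n) p)"
      by (simp add: distr)
    finally show ?case .
  qed
  show ?thesis
  proof (rule measure_eqI)
    fix A
    have "emeasure (distr (stream_space M) (count_space UNIV) (\<lambda>\<omega>. map f (stake n \<omega>))) A =
        (\<integral>\<^sup>+\<omega>. indicator A (map f (stake n \<omega>)) \<partial>stream_space M)"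
      by (subst nn_integral_indicator[symmetric], simp, subst nn_integral_distr) auto
    then show "emeasure (distr (stream_space M) (count_space UNIV) (\<lambda>\<omega>. map f (stake n \<omega>))) A =
      emeasure (measure_pmf (replicate_pmf n p)) A"
      by (simp add: nn)
  qed simp
qed

text \<open>The level-\<open>k\<close> profile depends on the first \<open>k\<close> bits of each record only. A record is
  therefore represented by the list of these bits, whose head directs it and is dropped on the
  way down.\<close>

fun bit_profile :: "nat \<Rightarrow> bool list list \<Rightarrow> nat" where
  "bit_profile k [] = (if k = 0 then 1 else 0)"
| "bit_profile 0 (r # rs) = 0"
| "bit_profile (Suc k) (r # rs) =
     bit_profile k (map tl (filter (\<lambda>s. \<not> hd s) rs)) + bit_profile k (map tl (filter hd rs))"

lemma external_nodes_at_dst: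
  "external_nodes_at (dst d rs) k = bit_profile k (map (\<lambda>s. stake k (sdrop d s)) rs)"
proof (induction k arbitrary: d rs)
  case 0
  show ?case by (cases rs) auto
next
  case (Suc k)
  have bits: "stake (Suc k) (sdrop d s) = s !! d # stake k (sdrop (Suc d) s)" for s :: "bool stream"
    by (simp only: stake.simps sdrop_simps)
  have "map tl (filter hd (map (\<lambda>s. stake (Suc k) (sdrop d s)) rs)) =
      map (\<lambda>s. stake k (sdrop (Suc d) s)) (filter (\<lambda>s. s !! d) rs)"
    "map tl (filter (\<lambda>r. \<not> hd r) (map (\<lambda>s. stake (Suc k) (sdrop d s)) rs)) =
      map (\<lambda>s. stake k (sdrop (Suc d) s)) (filter (\<lambda>s. \<not> s !! d) rs)" for rs
    by (induction rs) (simp_all add: bits del: stake.simps sdrop.simps)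
  then show ?case
    by (cases rs) (simp_all add: Suc.IH del: stake.simps sdrop.simps)
qed

abbreviation "coin \<equiv> pmf_of_set (UNIV :: bool set)"

definition bit_records :: "nat \<Rightarrow> nat \<Rightarrow> bool list list pmf" where
  "bit_records n k = replicate_pmf n (replicate_pmf k coin)"

definition profile_pmf :: "nat \<Rightarrow> nat \<Rightarrow> nat pmf" where
  "profile_pmf n k = map_pmf (bit_profile k) (bit_records n k)"

lemma distr_random_records:
  "distr random_records (count_space UNIV) (\<lambda>\<omega>. map (stake k) (stake n \<omega>)) = measure_pmf (bit_records n k)"
proof -
  note coin = measure_pmf.prob_space_axioms[of coin]
  have 1: "distr (stream_space (measure_pmf coin)) (count_space UNIV) (stake k) = measure_pmf (replicate_pmf k coin)"
    using distr_map_stake[OF coin, of "\<lambda>x. x" coin k]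
    by (simp add: distr_id2)
  have 2: "stake k \<in> stream_space (measure_pmf coin) \<rightarrow>\<^sub>M count_space UNIV"
    using measurable_map_stake[of "\<lambda>x. x" "measure_pmf coin"] by simp
  show ?thesis
    unfolding random_records_def bit_records_def
    by (rule distr_map_stake[OF prob_space.prob_space_stream_space[OF coin] 2 1])
qed

lemma expectation_external_profile:
  fixes \<phi> :: "real \<Rightarrow> real"
  shows "prob_space.expectation random_records (\<lambda>\<omega>. \<phi> (external_profile n k \<omega>)) =
    measure_pmf.expectation (profile_pmf n k) (\<lambda>b. \<phi> (real b))"
proof -
  have [measurable]: "(\<lambda>\<omega>. map (stake k) (stake n \<omega>)) \<in> random_records \<rightarrow>\<^sub>M count_space UNIV"
    unfolding random_records_def
    using measurable_map_stake[of "\<lambda>x. x" "measure_pmf coin"]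
    by (intro measurable_map_stake) simp
  have "measure_pmf.expectation (profile_pmf n k) (\<lambda>b. \<phi> (real b)) =
    measure_pmf.expectation (bit_records n k) (\<lambda>rs. \<phi> (real (bit_profile k rs)))"
    by (simp add: profile_pmf_def)
  also have "\<dots> = prob_space.expectation random_records
      (\<lambda>\<omega>. \<phi> (real (bit_profile k (map (stake k) (stake n \<omega>)))))"
    unfolding distr_random_records[symmetric] by (subst integral_distr) auto
  finally show ?thesis
    by (simp add: external_profile_def external_nodes_at_dst)
qed

section \<open>Splitting the records at the root\<close>

text \<open>The sizes of the left and the right subtree when \<open>n\<close> records arrive after the root was
  filled. The pair is kept instead of the binomial size of one subtree, so that no subtraction
  of naturals occurs and the two sides can be exchanged.\<close>

fun split_pmf :: "nat \<Rightarrow> (nat \<times> nat) pmf" where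
  "split_pmf 0 = return_pmf (0, 0)"
| "split_pmf (Suc n) = do {
     right \<leftarrow> coin; (i, j) \<leftarrow> split_pmf n;
     return_pmf (if right then (i, Suc j) else (Suc i, j))}"

lemma bit_records_Suc:
  "bit_records (Suc n) k = do {y \<leftarrow> replicate_pmf k coin; rs \<leftarrow> bit_records n k; return_pmf (y # rs)}"
  by (simp add: bit_records_def)

text \<open>Why the tree is recursive in distribution: given the sizes of the two subtrees, their record
  lists are independent and again uniform. Adding one record in front extends exactly one of
  the two lists by a uniform record, and this commutes with drawing the remaining ones.\<close>

lemma split_bit_records:
  "map_pmf (\<lambda>rs. (map tl (filter (\<lambda>s. \<not> hd s) rs), map tl (filter hd rs))) (bit_records n (Suc k)) =
   do {(i, j) \<leftarrow> split_pmf n; pair_pmf (bit_records i k) (bit_records j k)}"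
proof (induction n)
  case 0
  show ?case by (simp add: bit_records_def bind_return_pmf pair_return_pmf1)
next
  case (Suc n)
  let ?split = "\<lambda>rs. (map tl (filter (\<lambda>s. \<not> hd s) rs), map tl (filter hd rs))"
  let ?R = "replicate_pmf k coin"
  have "map_pmf ?split (bit_records (Suc n) (Suc k)) =
    do {b \<leftarrow> coin; y \<leftarrow> ?R; (l, r) \<leftarrow> map_pmf ?split (bit_records n (Suc k));
        return_pmf (if b then (l, y # r) else (y # l, r))}"
  proof -
    have "map_pmf ?split (bit_records (Suc n) (Suc k)) =
      do {b \<leftarrow> coin; y \<leftarrow> ?R; rs \<leftarrow> bit_records n (Suc k); return_pmf (?split ((b # y) # rs))}"
      by (simp only: bit_records_Suc replicate_pmf.simps map_bind_pmf bind_assoc_pmf bind_return_pmf map_return_pmf)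
    also have "\<dots> = do {b \<leftarrow> coin; y \<leftarrow> ?R; rs \<leftarrow> bit_records n (Suc k);
       (case ?split rs of (l, r) \<Rightarrow> return_pmf (if b then (l, y # r) else (y # l, r)))}"
      by (intro bind_pmf_cong refl) auto
    also have "\<dots> = do {b \<leftarrow> coin; y \<leftarrow> ?R; (l, r) \<leftarrow> map_pmf ?split (bit_records n (Suc k));
        return_pmf (if b then (l, y # r) else (y # l, r))}"
      by (simp only: bind_map_pmf)
    finally show ?thesis .
  qed
  also have "\<dots> = do {b \<leftarrow> coin; y \<leftarrow> ?R; (i, j) \<leftarrow> split_pmf n; l \<leftarrow> bit_records i k; r \<leftarrow> bit_records j k;
        return_pmf (if b then (l, y # r) else (y # l, r))}"
    unfolding Suc.IH
    by (simp only: pair_pmf_def bind_assoc_pmf bind_return_pmf case_prod_unfold fst_conv snd_conv)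
  also have "\<dots> = do {b \<leftarrow> coin; (i, j) \<leftarrow> split_pmf n; y \<leftarrow> ?R; l \<leftarrow> bit_records i k; r \<leftarrow> bit_records j k;
        return_pmf (if b then (l, y # r) else (y # l, r))}"
    unfolding case_prod_unfold by (subst bind_commute_pmf[of ?R]) (rule refl)
  also have "\<dots> = do {b \<leftarrow> coin; (i, j) \<leftarrow> split_pmf n;
        (case (if b then (i, Suc j) else (Suc i, j)) of (i, j) \<Rightarrow> pair_pmf (bit_records i k) (bit_records j k))}"
  proof (intro bind_pmf_cong refl, clarify)
    fix b i j
    show "do {y \<leftarrow> ?R; l \<leftarrow> bit_records i k; r \<leftarrow> bit_records j k;
        return_pmf (if b then (l, y # r) else (y # l, r))} =
      (case (if b then (i, Suc j) else (Suc i, j)) of (i, j) \<Rightarrow> pair_pmf (bit_records i k) (bit_records j k))"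
    proof (cases b)
      case True
      then show ?thesis
        by (simp add: pair_pmf_def bit_records_Suc bind_assoc_pmf bind_return_pmf)
          (rule bind_commute_pmf)
    next
      case False
      then show ?thesis
        by (simp add: pair_pmf_def bit_records_Suc bind_assoc_pmf bind_return_pmf)
    qed
  qed
  also have "\<dots> = do {(i, j) \<leftarrow> split_pmf (Suc n); pair_pmf (bit_records i k) (bit_records j k)}"
    by (simp add: bind_assoc_pmf bind_return_pmf case_prod_unfold)
  finally show ?case .
qed

lemma profile_pmf_0: "profile_pmf 0 k = return_pmf (if k = 0 then 1 else 0)"
  by (simp add: profile_pmf_def bit_records_def)

lemma profile_pmf_Suc_0: "profile_pmf (Suc n) 0 = return_pmf 0"
  by (simp add: profile_pmf_def bit_records_def map_bind_pmf bind_return_pmf)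

lemma profile_pmf_Suc_Suc:
  "profile_pmf (Suc n) (Suc k) = do {(i, j) \<leftarrow> split_pmf n;
     map_pmf (\<lambda>(x, y). x + y) (pair_pmf (profile_pmf i k) (profile_pmf j k))}"
proof -
  have "profile_pmf (Suc n) (Suc k) = map_pmf (\<lambda>(l, r). bit_profile k l + bit_profile k r)
    (map_pmf (\<lambda>rs. (map tl (filter (\<lambda>s. \<not> hd s) rs), map tl (filter hd rs))) (bit_records n (Suc k)))"
    unfolding profile_pmf_def
    by (subst bit_records_Suc) (simp add: map_pmf_def bind_assoc_pmf bind_return_pmf bind_pmf_const)
  then show ?thesis
    unfolding split_bit_records
    by (simp add: map_bind_pmf profile_pmf_def case_prod_unfold pair_map_pmf1 pair_map_pmf2
        map_pmf_comp)
qed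

section \<open>Averages and variances over a random split\<close>

text \<open>The expectation of \<open>h (J, n - J)\<close> for \<open>J\<close> binomial with parameters \<open>n\<close> and 1/2, unfolded one
  coin at a time.\<close>

primrec split_average :: "nat \<Rightarrow> (nat \<Rightarrow> nat \<Rightarrow> real) \<Rightarrow> real" where
  "split_average 0 h = h 0 0"
| "split_average (Suc n) h =
     (split_average n (\<lambda>i j. h (Suc i) j) + split_average n (\<lambda>i j. h i (Suc j))) / 2"

definition split_variance :: "nat \<Rightarrow> (nat \<Rightarrow> nat \<Rightarrow> real) \<Rightarrow> real" where
  "split_variance n h = split_average n (\<lambda>i j. (h i j)\<^sup>2) - (split_average n h)\<^sup>2"

lemma split_average_add:
  "split_average n (\<lambda>i j. f i j + g i j) = split_average n f + split_average n g"
  by (induction n arbitrary: f g) (simp_all add: field_simps)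

lemma split_average_diff:
  "split_average n (\<lambda>i j. f i j - g i j) = split_average n f - split_average n g"
  by (induction n arbitrary: f g) (simp_all add: diff_divide_distrib add_divide_distrib)

lemma split_average_cmult: "split_average n (\<lambda>i j. c * f i j) = c * split_average n f"
  by (induction n arbitrary: f) (simp_all add: field_simps)

lemma split_average_const [simp]: "split_average n (\<lambda>i j. c) = c"
  by (induction n) simp_all

lemma split_average_mono:
  "(\<And>i j. f i j \<le> g i j) \<Longrightarrow> split_average n f \<le> split_average n g"
  by (induction n arbitrary: f g) (simp_all add: add_mono)

lemma split_average_nonneg: "(\<And>i j. 0 \<le> f i j) \<Longrightarrow> 0 \<le> split_average n f"
  by (induction n arbitrary: f) simp_all

lemma split_average_swap: "split_average n (\<lambda>i j. h j i) = split_average n h"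
proof (induction n arbitrary: h)
  case (Suc n)
  show ?case
    using Suc[of "\<lambda>i j. h (Suc i) j"] Suc[of "\<lambda>i j. h i (Suc j)"] by simp
qed simp

lemma split_average_fst_plus_snd:
  "split_average n (\<lambda>i j. f i + f j) = 2 * split_average n (\<lambda>i j. f i)"
  using split_average_swap[of n "\<lambda>i j. f i"] by (simp add: split_average_add)

lemma split_average_ge_point:
  assumes "\<And>i. 0 \<le> f i" "m \<le> n"
  shows "f m / 2 ^ n \<le> split_average n (\<lambda>i j. f i)"
  using assms
proof (induction n arbitrary: f m)
  case (Suc n)
  show ?case
  proof (cases m)
    case 0
    then show ?thesis
      using Suc.IH[of f 0] Suc.prems split_average_nonneg[of "\<lambda>i j. f (Suc i)" n]
      by (simp add: divide_simps) (simp add: algebra_simps add_increasing2)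
  next
    case (Suc l)
    then show ?thesis
      using Suc.IH[of "\<lambda>i. f (Suc i)" l] Suc.prems split_average_nonneg[of "\<lambda>i j. f i" n]
      by (simp add: divide_simps) (simp add: algebra_simps add_increasing)
  qed
qed simp

text \<open>The law of total variance, conditioning on the first coin.\<close>

lemma split_variance_Suc:
  "split_variance (Suc n) h =
    (split_variance n (\<lambda>i j. h (Suc i) j) + split_variance n (\<lambda>i j. h i (Suc j))) / 2 +
    (split_average n (\<lambda>i j. h (Suc i) j - h i (Suc j)))\<^sup>2 / 4"
  by (simp add: split_variance_def split_average_diff power2_eq_square field_simps)

lemma split_variance_nonneg: "0 \<le> split_variance n h"
  by (induction n arbitrary: h) (simp_all add: split_variance_Suc, simp add: split_variance_def)

text \<open>The Efron--Stein inequality for \<open>n + 1\<close> coins: redirecting one record to the other subtree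
  changes \<open>h\<close> by the discrete derivative \<open>h (i + 1) j - h i (j + 1)\<close>.\<close>

lemma split_variance_Suc_le:
  "split_variance (Suc n) h \<le>
    (real n + 1) / 4 * split_average n (\<lambda>i j. (h (Suc i) j - h i (Suc j))\<^sup>2)"
proof (induction n arbitrary: h)
  case 0
  show ?case by (simp add: split_variance_def power2_eq_square field_simps)
next
  case (Suc n)
  let ?d = "\<lambda>i j. h (Suc i) j - h i (Suc j)"
  have jensen: "(split_average (Suc n) ?d)\<^sup>2 \<le> split_average (Suc n) (\<lambda>i j. (?d i j)\<^sup>2)"
    using split_variance_nonneg[of "Suc n" ?d] by (simp only: split_variance_def)
  have "split_variance (Suc (Suc n)) h \<le>
    (real n + 1) / 4 * split_average (Suc n) (\<lambda>i j. (?d i j)\<^sup>2) +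
    (split_average (Suc n) ?d)\<^sup>2 / 4"
    unfolding split_variance_Suc[of "Suc n"]
    using Suc[of "\<lambda>i j. h (Suc i) j"] Suc[of "\<lambda>i j. h i (Suc j)"]
    by (simp add: field_simps)
  with jensen show ?case by (simp only: of_nat_Suc) (simp add: field_simps)
qed

text \<open>Choosing a coin and requiring that it shows \<open>left\<close> can be done before or after the tosses.\<close>

lemma split_average_size_bias:
  "(real n + 1) * split_average n (\<lambda>i j. f (Suc i)) = 2 * split_average (Suc n) (\<lambda>i j. real i * f i)"
proof (induction n arbitrary: f)
  case (Suc n)
  have "2 * split_average (Suc (Suc n)) (\<lambda>i j. real i * f i) =
      split_average (Suc n) (\<lambda>i j. real i * f (Suc i) + f (Suc i)) +
      split_average (Suc n) (\<lambda>i j. real i * f i)"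
    by (simp only: split_average.simps(2)[of "Suc n"])
      (simp add: distrib_right add_ac del: split_average.simps)
  also have "\<dots> = (real n + 1) / 2 * split_average n (\<lambda>i j. f (Suc (Suc i))) +
      split_average (Suc n) (\<lambda>i j. f (Suc i)) + (real n + 1) / 2 * split_average n (\<lambda>i j. f (Suc i))"
    using Suc[of f] Suc[of "\<lambda>i. f (Suc i)"] by (simp only: split_average_add)
  also have "\<dots> = (real (Suc n) + 1) * split_average (Suc n) (\<lambda>i j. f (Suc i))"
    by (simp only: split_average.simps(2)[of n] of_nat_Suc) (simp add: field_simps)
  finally show ?case by (rule sym)
qed simp

lemma split_average_size_bias2:
  "(real n + 1) * (real n + 2) * split_average n (\<lambda>i j. f (Suc (Suc i))) =
    4 * split_average (Suc (Suc n)) (\<lambda>i j. real i * (real i - 1) * f i)"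
proof -
  have "(real n + 1) * (real n + 2) * split_average n (\<lambda>i j. f (Suc (Suc i))) =
    2 * ((real (Suc n) + 1) * split_average (Suc n) (\<lambda>i j. (real (Suc i) - 1) * f (Suc i)))"
    using split_average_size_bias[of n "\<lambda>i. f (Suc i)"] by (simp del: split_average.simps) algebra
  also have "\<dots> = 4 * split_average (Suc (Suc n)) (\<lambda>i j. real i * ((real i - 1) * f i))"
    by (subst split_average_size_bias) simp
  finally show ?thesis by (simp add: mult.assoc)
qed

text \<open>The discrete derivative of \<open>f i + f j\<close> is a difference of two equally distributed terms and
  so has average 0. Hence its second moment is a variance and the Efron--Stein inequality
  applies to it again, which bounds the variance by \<open>n (n - 1)\<close> times the average of the
  squared second difference of \<open>f\<close>. Size biasing turns the factor \<open>n (n - 1)\<close> into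
  \<open>i (i - 1)\<close>, so that a pointwise bound on the second difference is all that is needed.\<close>

lemma split_variance_symmetric_le:
  assumes curv: "\<And>i. (real i + 1) * (real i + 2) * (f (i + 2) - 2 * f (i + 1) + f i)\<^sup>2 \<le> c * f (i + 2)"
    and nonneg: "\<And>i. 0 \<le> f i" "0 \<le> c"
  shows "split_variance n (\<lambda>i j. f i + f j) \<le> c * split_average n (\<lambda>i j. f i)"
proof -
  let ?h = "\<lambda>i j. f i + f j" and ?d = "\<lambda>i j. (f (i + 1) - f i) - (f (j + 1) - f j)"
  let ?c = "\<lambda>i. f (i + 2) - 2 * f (i + 1) + f i"
  have rhs: "0 \<le> c * split_average n (\<lambda>i j. f i)"
    by (intro mult_nonneg_nonneg split_average_nonneg nonneg)
  consider "n = 0" | "n = 1" | m where "n = Suc (Suc m)"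
    by (metis One_nat_def not0_implies_Suc)
  then show ?thesis
  proof cases
    case 1
    then show ?thesis using rhs by (simp add: split_variance_def)
  next
    case 2
    then show ?thesis using rhs by (simp add: split_variance_def power2_eq_square field_simps)
  next
    case (3 m)
    have d0: "split_average (Suc m) ?d = 0"
      using split_average_swap[of "Suc m" "\<lambda>i j. f (i + 1) - f i"] by (simp only: split_average_diff)
    have f0: "0 \<le> c * f (Suc (Suc i)) / ((real i + 1) * (real i + 2))" for i
      using nonneg by simp
    have sq: "(x + y)\<^sup>2 \<le> 2 * x\<^sup>2 + 2 * y\<^sup>2" for x y :: real
      using zero_le_power2[of "x - y"] by (simp add: power2_sum power2_diff)
    let ?g = "\<lambda>i. c * f i / (real i * (real i - 1))"
    have "split_variance n ?h \<le> (real m + 2) / 4 * split_average (Suc m) (\<lambda>i j. (?d i j)\<^sup>2)"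
      using split_variance_Suc_le[of "Suc m" ?h] 3 by (simp add: algebra_simps)
    also have "\<dots> = (real m + 2) / 4 * split_variance (Suc m) ?d"
      unfolding split_variance_def d0 by simp
    also have "\<dots> \<le> (real m + 2) / 4 * ((real m + 1) / 4 * split_average m (\<lambda>i j. (?c i + ?c j)\<^sup>2))"
      using split_variance_Suc_le[of m ?d]
      by (intro mult_left_mono) (simp_all add: algebra_simps numeral_2_eq_2)
    also have "\<dots> \<le> (real m + 2) / 4 * ((real m + 1) / 4 *
        split_average m (\<lambda>i j. 2 * (?c i)\<^sup>2 + 2 * (?c j)\<^sup>2))"
      by (intro mult_left_mono split_average_mono sq) simp_all
    also have "\<dots> = (real m + 2) / 4 * ((real m + 1) * split_average m (\<lambda>i j. (?c i)\<^sup>2))"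
      by (simp add: split_average_fst_plus_snd split_average_cmult)
    also have "\<dots> \<le> (real m + 2) / 4 * ((real m + 1) * split_average m (\<lambda>i j. ?g (Suc (Suc i))))"
      using curv
      by (intro mult_left_mono split_average_mono) (simp_all add: pos_le_divide_eq mult_ac add_ac)
    also have "\<dots> = 1 / 4 * ((real m + 1) * (real m + 2) * split_average m (\<lambda>i j. ?g (Suc (Suc i))))"
      by simp
    also have "\<dots> = split_average n (\<lambda>i j. real i * (real i - 1) * ?g i)"
      unfolding split_average_size_bias2[of m ?g] 3 by (simp del: split_average.simps)
    also have "\<dots> \<le> split_average n (\<lambda>i j. c * f i)"
      using nonneg by (intro split_average_mono) simp
    finally show ?thesis by (simp only: split_average_cmult)
  qed
qed

section \<open>Mean and variance of the profile\<close>

lemma finite_split_pmf: "finite (set_pmf (split_pmf n))"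
  by (induction n) auto

lemma finite_profile_pmf: "finite (set_pmf (profile_pmf n k))"
proof -
  have "finite {xs. set xs \<subseteq> {ys :: bool list. length ys = k} \<and> length xs = n}"
    using finite_lists_length_eq[of "UNIV :: bool set" k] by (intro finite_lists_length_eq) simp
  then show ?thesis
    by (simp add: profile_pmf_def bit_records_def set_replicate_pmf lists_eq_set)
qed

lemma expectation_bind_pmf_finite:
  fixes h :: "'b \<Rightarrow> real"
  assumes "finite (set_pmf p)" "\<And>x. finite (set_pmf (f x))"
  shows "measure_pmf.expectation (bind_pmf p f) h =
    measure_pmf.expectation p (\<lambda>x. measure_pmf.expectation (f x) h)"
  using assms by (simp add: pmf_expectation_bind[of "set_pmf p"] integral_measure_pmf[of "set_pmf p"])

lemma expectation_split_pmf:
  "measure_pmf.expectation (split_pmf n) (\<lambda>(i, j). h i j) = split_average n h"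
proof (induction n arbitrary: h)
  case (Suc n)
  have "measure_pmf.expectation (split_pmf (Suc n)) (\<lambda>(i, j). h i j) =
    measure_pmf.expectation coin (\<lambda>b. measure_pmf.expectation (split_pmf n)
      (\<lambda>(i, j). if b then h i (Suc j) else h (Suc i) j))"
    by (simp add: expectation_bind_pmf_finite finite_split_pmf case_prod_unfold)
      (auto intro!: Bochner_Integration.integral_cong)
  also have "\<dots> = split_average (Suc n) h"
    by (simp add: integral_pmf_of_set UNIV_bool Suc)
  finally show ?case .
qed simp

lemma expectation_profile_Suc_Suc:
  fixes \<phi> :: "nat \<Rightarrow> real"
  shows "measure_pmf.expectation (profile_pmf (Suc n) (Suc k)) \<phi> =
    split_average n (\<lambda>i j. measure_pmf.expectation (profile_pmf i k) (\<lambda>x.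
      measure_pmf.expectation (profile_pmf j k) (\<lambda>y. \<phi> (x + y))))"
proof -
  have "measure_pmf.expectation (profile_pmf (Suc n) (Suc k)) \<phi> =
    measure_pmf.expectation (split_pmf n) (\<lambda>(i, j). measure_pmf.expectation (profile_pmf i k) (\<lambda>x.
      measure_pmf.expectation (profile_pmf j k) (\<lambda>y. \<phi> (x + y))))"
    by (simp add: profile_pmf_Suc_Suc pair_pmf_def expectation_bind_pmf_finite finite_split_pmf
        finite_profile_pmf case_prod_unfold)
  then show ?thesis by (simp add: expectation_split_pmf)
qed

lemma mean_profile_eq: "mean_profile n k = measure_pmf.expectation (profile_pmf n k) real"
  unfolding mean_profile_def using expectation_external_profile[of "\<lambda>x. x"] by simp

lemma integrable_profile [simp]: "integrable (measure_pmf (profile_pmf n k)) (f :: nat \<Rightarrow> real)"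
  by (intro integrable_measure_pmf_finite finite_profile_pmf)

lemma var_profile_eq:
  "var_profile n k = measure_pmf.expectation (profile_pmf n k) (\<lambda>b. (real b)\<^sup>2) - (mean_profile n k)\<^sup>2"
proof -
  have "var_profile n k = measure_pmf.variance (profile_pmf n k) real"
    unfolding var_profile_def mean_profile_def[symmetric] mean_profile_eq[symmetric]
    by (rule expectation_external_profile)
  then show ?thesis
    by (simp add: measure_pmf.variance_eq mean_profile_eq)
qed

lemma mean_profile_0: "mean_profile 0 k = (if k = 0 then 1 else 0)"
  by (simp add: mean_profile_eq profile_pmf_0)

lemma mean_profile_Suc_0: "mean_profile (Suc n) 0 = 0"
  by (simp add: mean_profile_eq profile_pmf_Suc_0)

lemma mean_profile_Suc_Suc:
  "mean_profile (Suc n) (Suc k) = split_average n (\<lambda>i j. mean_profile i k + mean_profile j k)"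
  by (simp add: mean_profile_eq expectation_profile_Suc_Suc)

lemma var_profile_0: "var_profile 0 k = 0"
  by (simp add: var_profile_eq mean_profile_0 profile_pmf_0)

text \<open>The law of total variance for the split at the root: the variance is inherited from the
  subtrees, plus a toll, namely the variance of the conditional mean.\<close>

lemma var_profile_Suc_Suc:
  "var_profile (Suc n) (Suc k) =
    split_average n (\<lambda>i j. var_profile i k + var_profile j k) +
    split_variance n (\<lambda>i j. mean_profile i k + mean_profile j k)"
proof -
  let ?E2 = "\<lambda>n k. measure_pmf.expectation (profile_pmf n k) (\<lambda>b. (real b)\<^sup>2)"
  have "?E2 (Suc n) (Suc k) =
      split_average n (\<lambda>i j. ?E2 i k + ?E2 j k + 2 * mean_profile i k * mean_profile j k)"
    by (simp add: expectation_profile_Suc_Suc power2_sum mean_profile_eq)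
  also have "\<dots> = split_average n (\<lambda>i j. (var_profile i k + var_profile j k) +
      (mean_profile i k + mean_profile j k)\<^sup>2)"
    by (simp add: var_profile_eq power2_sum algebra_simps)
  finally show ?thesis
    unfolding var_profile_eq[of "Suc n"] mean_profile_Suc_Suc split_variance_def
    by (simp add: split_average_add)
qed

lemma var_profile_nonneg: "0 \<le> var_profile n k"
  unfolding var_profile_def by (intro Bochner_Integration.integral_nonneg) simp

lemma bit_profile_le: "bit_profile k rs \<le> 2 ^ k"
proof (induction k arbitrary: rs)
  case (Suc k)
  have "bit_profile k ls + bit_profile k rs \<le> 2 ^ Suc k" for ls rs
    using add_mono[OF Suc[of ls] Suc[of rs]] by simp
  then show ?case
    by (cases rs) simp_all
next
  case 0
  then show ?case by (cases rs) auto
qed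

lemma profile_pmf_le: "b \<in> set_pmf (profile_pmf n k) \<Longrightarrow> b \<le> 2 ^ k"
  by (auto simp: profile_pmf_def bit_profile_le)

lemma mean_profile_nonneg: "0 \<le> mean_profile n k"
  by (simp add: mean_profile_eq)

lemma mean_profile_le: "mean_profile n k \<le> 2 ^ k"
  unfolding mean_profile_eq
  by (rule measure_pmf.integral_le_const) (auto simp: AE_measure_pmf_iff dest: profile_pmf_le)

lemma var_profile_le_power_mult_mean: "var_profile n k \<le> 2 ^ k * mean_profile n k"
proof -
  have "measure_pmf.expectation (profile_pmf n k) (\<lambda>b. (real b)\<^sup>2) \<le>
    measure_pmf.expectation (profile_pmf n k) (\<lambda>b. 2 ^ k * real b)"
    by (intro integral_mono_AE)
       (auto simp: AE_measure_pmf_iff power2_eq_square intro!: mult_right_mono dest: profile_pmf_le)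
  moreover have "var_profile n k \<le> measure_pmf.expectation (profile_pmf n k) (\<lambda>b. (real b)\<^sup>2)"
    by (simp add: var_profile_eq)
  ultimately show ?thesis by (simp add: mean_profile_eq)
qed

text \<open>The profile takes integer values, so it is at most its square.\<close>

lemma mean_mult_one_minus_mean_le_var_profile: "mean_profile n k * (1 - mean_profile n k) \<le> var_profile n k"
proof -
  have "real b \<le> (real b)\<^sup>2" for b :: nat
    by (cases b) (auto simp: power2_eq_square)
  then have "measure_pmf.expectation (profile_pmf n k) real \<le>
    measure_pmf.expectation (profile_pmf n k) (\<lambda>b. (real b)\<^sup>2)"
    by (intro integral_mono) auto
  then show ?thesis by (simp add: var_profile_eq mean_profile_eq algebra_simps power2_eq_square)
qed

section \<open>The external node on a fixed path\<close>

text \<open>The next record fills any given external node at level \<open>k\<close> with probability \<open>1 / 2 ^ k\<close>, and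
  this creates two external nodes at level \<open>k + 1\<close>. The proof obtains it from the recurrence
  at the root.\<close>

lemma mean_profile_Suc_left:
  "mean_profile (Suc n) (Suc k) =
    (1 - 1 / 2 ^ Suc k) * mean_profile n (Suc k) + 4 / 2 ^ Suc k * mean_profile n k"
proof (induction k arbitrary: n)
  case 0
  show ?case
  proof (cases n)
    case 0
    then show ?thesis by (simp add: mean_profile_Suc_Suc mean_profile_0)
  next
    case (Suc m)
    then show ?thesis
      by (simp add: mean_profile_Suc_Suc mean_profile_Suc_0 split_average_add field_simps)
  qed
next
  case (Suc k)
  show ?case
  proof (cases n)
    case 0
    then show ?thesis by (simp add: mean_profile_Suc_Suc mean_profile_0)
  next
    case (Suc m)
    let ?u = "\<lambda>i. mean_profile i (Suc k)" and ?v = "\<lambda>i. mean_profile i k"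
    let ?A = "\<lambda>f. split_average m (\<lambda>i j. f i)"
    have sw: "split_average m (\<lambda>i j. f j) = ?A f" for f
      using split_average_swap[of m "\<lambda>i j. f i"] by simp
    have halves: "(x + y + z) / 2 + (z + (x + y)) / 2 = x + y + z" for x y z :: real
      by (simp add: field_simps)
    have "mean_profile (Suc n) (Suc (Suc k)) =
        ?A (\<lambda>i. (1 - 1 / 2 ^ Suc k) * ?u i + 4 / 2 ^ Suc k * ?v i) + ?A ?u"
      unfolding mean_profile_Suc_Suc[of n]
      by (simp add: \<open>n = Suc m\<close> Suc.IH split_average_add sw del: power_Suc) (rule halves)
    also have "\<dots> = (2 - 1 / 2 ^ Suc k) * ?A ?u + 4 / 2 ^ Suc k * ?A ?v"
      by (simp only: split_average_add split_average_cmult) (simp add: algebra_simps)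
    also have "\<dots> = (1 - 1 / 2 ^ Suc (Suc k)) * mean_profile n (Suc (Suc k)) +
        4 / 2 ^ Suc (Suc k) * mean_profile n (Suc k)"
      unfolding Suc mean_profile_Suc_Suc split_average_fst_plus_snd by (simp add: field_simps)
    finally show ?thesis .
  qed
qed

text \<open>The probability that an arbitrary fixed infinite path from the root meets its external node
  at level \<open>k\<close>. In \<open>n\<close>, this level is a Markov chain that moves from \<open>k\<close> to \<open>k + 1\<close> with
  probability \<open>1 / 2 ^ k\<close>.\<close>

definition path_prob :: "nat \<Rightarrow> nat \<Rightarrow> real" where
  "path_prob n k = mean_profile n k / 2 ^ k"

lemma path_prob_0: "path_prob 0 k = (if k = 0 then 1 else 0)"
  by (simp add: path_prob_def mean_profile_0)

lemma path_prob_Suc_0: "path_prob (Suc n) 0 = 0"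
  by (simp add: path_prob_def mean_profile_Suc_0)

lemma path_prob_Suc_Suc:
  "path_prob (Suc n) (Suc k) = (1 - 1 / 2 ^ Suc k) * path_prob n (Suc k) + path_prob n k / 2 ^ k"
  by (simp add: path_prob_def mean_profile_Suc_left field_simps)

lemma path_prob_nonneg: "0 \<le> path_prob n k"
  by (simp add: path_prob_def mean_profile_nonneg)

lemma path_prob_le_1: "path_prob n k \<le> 1"
  using mean_profile_le[of n k] by (simp add: path_prob_def)

text \<open>With \<open>a i = 1 - 1 / 2 ^ i\<close>, the number \<open>path_prob n k\<close> is the product of \<open>1 / 2 ^ i\<close> over
  \<open>i < k\<close> times the complete homogeneous symmetric polynomial \<open>H d\<close> of degree \<open>d = n - k\<close> in
  \<open>a 0, \<dots>, a k\<close>. Doubling the variables one at a time and adding the results gives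
  \<open>(d + k + 1) * H d\<close>; since \<open>a (k + 1)\<close> exceeds all of them, each result is at most the
  polynomial with the additional variable \<open>a (k + 1)\<close>, which is the claim. The induction below
  is an elementary version: by the recurrence, the claim for \<open>n\<close> and \<open>k\<close> is equivalent to
  \<open>(n - k) * path_prob n k \<le> (k + 1) * 2 ^ k * a (k + 1) * path_prob n (k + 1)\<close>.\<close>

lemma path_prob_le_descend:
  "(real n + 1) * path_prob n k \<le> (real k + 1) * 2 ^ k * path_prob (Suc n) (Suc k)"
proof (induction n arbitrary: k)
  case 0
  show ?case by (simp add: path_prob_0 path_prob_Suc_Suc)
next
  case (Suc n)
  show ?case
  proof (cases k)
    case 0
    then show ?thesis using path_prob_nonneg by (simp add: path_prob_Suc_0)
  next
    case (Suc l)
    let ?p = "path_prob n k" and ?a = "1 - 1 / 2 ^ k :: real" and ?b = "1 - 1 / 2 ^ Suc k :: real"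
    \<comment> \<open>The equivalent form of the claim, one level higher up in the tree.\<close>
    have stay: "(real n - l) * path_prob n l \<le> (real l + 1) * 2 ^ l * ?a * ?p"
    proof -
      have "(real n + 1) * path_prob n l \<le> (real l + 1) * 2 ^ l * (?a * ?p + path_prob n l / 2 ^ l)"
        using Suc.IH[of l] by (simp only: path_prob_Suc_Suc Suc)
      also have "\<dots> = (real l + 1) * 2 ^ l * ?a * ?p + (real l + 1) * path_prob n l"
        by (simp add: distrib_left)
      finally show ?thesis by (simp add: distrib_right left_diff_distrib)
    qed
    have "(real n + 1 - k) * path_prob (Suc n) k =
        (real n - l) * ?a * ?p + (real n - l) * path_prob n l / 2 ^ l"
      unfolding Suc path_prob_Suc_Suc by (simp add: algebra_simps)
    also have "\<dots> \<le> (real n - l) * ?a * ?p + (real l + 1) * ?a * ?p"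
      using stay by (intro add_left_mono) (simp add: pos_divide_le_eq mult_ac)
    also have "\<dots> = ?a * ((real n + 1) * ?p)"
      by (simp add: algebra_simps add_divide_distrib diff_divide_distrib)
    also have "\<dots> \<le> ?b * ((real k + 1) * 2 ^ k * path_prob (Suc n) (Suc k))"
    proof (rule mult_mono)
      show "?a \<le> ?b" by (simp add: field_simps)
      show "0 \<le> ?b" by (simp add: divide_le_eq_1 del: power_Suc)
      show "(real n + 1) * ?p \<le> (real k + 1) * 2 ^ k * path_prob (Suc n) (Suc k)" by (rule Suc.IH)
      show "0 \<le> (real n + 1) * ?p" by (simp add: path_prob_nonneg)
    qed
    also have "\<dots> = (real k + 1) * 2 ^ k * (?b * path_prob (Suc n) (Suc k))"
      by (rule mult.left_commute)
    finally have "(real n + 1 - k) * path_prob (Suc n) k + (real k + 1) * path_prob (Suc n) k \<le>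
      (real k + 1) * 2 ^ k * (?b * path_prob (Suc n) (Suc k)) + (real k + 1) * path_prob (Suc n) k"
      by (rule add_right_mono)
    also have "\<dots> = (real k + 1) * 2 ^ k * path_prob (Suc (Suc n)) (Suc k)"
      unfolding path_prob_Suc_Suc[of "Suc n"] distrib_left by simp
    also have "(real n + 1 - k) * path_prob (Suc n) k + (real k + 1) * path_prob (Suc n) k =
      (real (Suc n) + 1) * path_prob (Suc n) k"
      by (simp add: algebra_simps)
    finally show ?thesis .
  qed
qed

text \<open>Differences in \<open>n\<close> are combinations of neighbouring levels, each with a gain of \<open>1 / 2 ^ k\<close>.\<close>

lemma mean_profile_second_difference:
  "mean_profile (n + 2) (k + 2) - 2 * mean_profile (n + 1) (k + 2) + mean_profile n (k + 2) =
    (8 * path_prob n k - 6 * path_prob n (k + 1) + path_prob n (k + 2)) / 2 ^ (k + 2)"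
proof -
  have m: "mean_profile i j = 2 ^ j * path_prob i j" for i j by (simp add: path_prob_def)
  show ?thesis
    by (simp add: m path_prob_Suc_Suc numeral_2_eq_2 field_simps)
qed

text \<open>Multiplying a probability by \<open>n / 2 ^ k\<close> costs one level (\<open>path_prob_le_descend\<close>), and here
  each of the three probabilities in the second difference occurs squared, multiplied by
  \<open>n\<^sup>2 / 4 ^ k\<close>. Of the two factors in the square, one is to become the probability for level
  \<open>k\<close> and the other a constant. From level \<open>k - 2\<close> both multiplications are spent on the first
  factor, from level \<open>k - 1\<close> one on each, and from level \<open>k\<close> both on the second, which moves
  it to level \<open>k + 2\<close>, where it is at most 1. The result is smaller than the mean by the
  summable factor \<open>k\<^sup>2 / 2 ^ k\<close>, up to a constant.\<close>

lemma mean_profile_second_difference_le: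
  assumes "2 \<le> k"
  shows "(real n + 1) * (real n + 2) *
      (mean_profile (n + 2) k - 2 * mean_profile (n + 1) k + mean_profile n k)\<^sup>2
    \<le> 156 * (real k + 2)\<^sup>2 / 2 ^ k * mean_profile (n + 2) k"
proof -
  obtain l where k: "k = l + 2" using assms by (metis add.commute le_Suc_ex)
  define u v w q where "u = path_prob n l" and "v = path_prob n (l + 1)"
    and "w = path_prob n (l + 2)" and "q = path_prob (n + 2) (l + 2)"
  define s where "s = path_prob (n + 1) (l + 2)"
  define K Y N where "K = real k" and "Y = (2::real) ^ k" and "N = real n"
  have pos: "0 \<le> u" "0 \<le> v" "0 \<le> w" "0 \<le> q" "0 \<le> s" "u \<le> 1" "v \<le> 1" "w \<le> 1" "s \<le> 1" "q \<le> 1"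
    unfolding u_def v_def w_def q_def s_def by (simp_all add: path_prob_nonneg path_prob_le_1)
  have K: "2 \<le> K" and N: "0 \<le> N" and Y: "0 < Y" by (simp_all add: K_def N_def Y_def k)
  have half: "path_prob i (l + 2) \<le> 2 * path_prob (i + 1) (l + 2)" for i
  proof -
    have "1 / 2 ^ Suc (l + 1) \<le> (1 / 2 :: real)"
      using one_le_power[of "2 :: real" "l + 1"] by (simp add: field_simps)
    then have "1 / 2 * path_prob i (l + 2) \<le> (1 - 1 / 2 ^ Suc (l + 1)) * path_prob i (l + 2)"
      by (intro mult_right_mono path_prob_nonneg) simp
    moreover have "path_prob (i + 1) (l + 2) =
        (1 - 1 / 2 ^ Suc (l + 1)) * path_prob i (l + 2) + path_prob i (l + 1) / 2 ^ (l + 1)"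
      using path_prob_Suc_Suc[of i "l + 1"] by simp
    moreover have "0 \<le> path_prob i (l + 1) / 2 ^ (l + 1)"
      by (simp add: path_prob_nonneg)
    ultimately show ?thesis by linarith
  qed
  have sq: "s \<le> 2 * q" and ws: "w \<le> 2 * s"
    using half[of "n + 1"] half[of n] by (simp_all add: s_def q_def w_def)
  have u: "(N + 1) * (N + 2) * u \<le> K\<^sup>2 * Y\<^sup>2 / 8 * q"
  proof -
    let ?t = "path_prob (n + 1) (l + 1)"
    have 1: "(N + 1) * u \<le> (K - 1) * (Y / 4) * ?t"
      using path_prob_le_descend[of n l] by (simp add: N_def K_def Y_def u_def k add_ac)
    have 2: "(N + 2) * ?t \<le> K * (Y / 2) * q"
      using path_prob_le_descend[of "n + 1" "l + 1"] by (simp add: N_def K_def Y_def q_def k add_ac)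
    have "(N + 1) * (N + 2) * u = (N + 2) * ((N + 1) * u)" by simp
    also have "\<dots> \<le> (N + 2) * ((K - 1) * (Y / 4) * ?t)"
      using 1 N by (intro mult_left_mono) auto
    also have "\<dots> = (K - 1) * (Y / 4) * ((N + 2) * ?t)" by simp
    also have "\<dots> \<le> (K - 1) * (Y / 4) * (K * (Y / 2) * q)"
      using 2 K Y by (intro mult_left_mono) auto
    also have "\<dots> = (K - 1) * (K * Y\<^sup>2 / 8 * q)"
      by (simp add: power2_eq_square)
    also have "\<dots> \<le> K * (K * Y\<^sup>2 / 8 * q)"
      using K Y pos by (intro mult_right_mono) auto
    finally show ?thesis by (simp add: power2_eq_square)
  qed
  have v: "(N + 1) * v \<le> K * (Y / 2) * s"
    using path_prob_le_descend[of n "l + 1"] by (simp add: N_def K_def Y_def v_def s_def k add_ac)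
  have w: "(N + 1) * (N + 2) * w \<le> 2 * (K + 2)\<^sup>2 * Y\<^sup>2"
  proof -
    let ?t = "path_prob (n + 1) (l + 3)"
    have 1: "(N + 1) * w \<le> (K + 1) * Y * ?t"
      using path_prob_le_descend[of n "l + 2"] by (simp add: N_def K_def Y_def w_def k numeral_3_eq_3)
    have 2: "(N + 2) * ?t \<le> (K + 2) * (2 * Y)"
    proof -
      have "(N + 2) * ?t \<le> (K + 2) * (2 * Y) * path_prob (n + 2) (l + 4)"
        using path_prob_le_descend[of "n + 1" "l + 3"]
        by (simp add: N_def K_def Y_def k eval_nat_numeral add_ac)
      also have "\<dots> \<le> (K + 2) * (2 * Y) * 1"
        using K Y by (intro mult_left_mono path_prob_le_1) auto
      finally show ?thesis by simp
    qed
    have "(N + 1) * (N + 2) * w = (N + 2) * ((N + 1) * w)" by simp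
    also have "\<dots> \<le> (N + 2) * ((K + 1) * Y * ?t)"
      using 1 N by (intro mult_left_mono) auto
    also have "\<dots> = (K + 1) * Y * ((N + 2) * ?t)" by simp
    also have "\<dots> \<le> (K + 1) * Y * ((K + 2) * (2 * Y))"
      using 2 K Y by (intro mult_left_mono) auto
    also have "\<dots> = (K + 1) * (2 * (K + 2) * Y\<^sup>2)"
      by (simp add: power2_eq_square)
    also have "\<dots> \<le> (K + 2) * (2 * (K + 2) * Y\<^sup>2)"
      using K Y pos by (intro mult_right_mono) auto
    finally show ?thesis by (simp add: power2_eq_square algebra_simps)
  qed
  have KK: "K\<^sup>2 * Y\<^sup>2 * q \<le> (K + 2)\<^sup>2 * Y\<^sup>2 * q"
    using K pos by (intro mult_right_mono power_mono) auto
  have u2: "(N + 1) * (N + 2) * u\<^sup>2 \<le> (K + 2)\<^sup>2 * Y\<^sup>2 * q / 8"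
  proof -
    have "(N + 1) * (N + 2) * u * u \<le> K\<^sup>2 * Y\<^sup>2 / 8 * q * 1"
      using pos by (intro mult_mono[OF u]) auto
    with KK show ?thesis by (simp add: power2_eq_square[of u])
  qed
  have v2: "(N + 1) * (N + 2) * v\<^sup>2 \<le> (K + 2)\<^sup>2 * Y\<^sup>2 * q"
  proof -
    have "(N + 1) * (N + 2) * v\<^sup>2 \<le> (N + 1) * (2 * (N + 1)) * v\<^sup>2"
      using N by (intro mult_right_mono mult_left_mono) auto
    also have "\<dots> = 2 * ((N + 1) * v)\<^sup>2"
      by (simp add: power2_eq_square)
    also have "\<dots> \<le> 2 * (K * (Y / 2) * s)\<^sup>2"
      using v N pos by (intro mult_left_mono power_mono) auto
    also have "\<dots> = K\<^sup>2 * Y\<^sup>2 / 2 * (s * s)"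
      by (simp add: power2_eq_square)
    also have "\<dots> \<le> K\<^sup>2 * Y\<^sup>2 / 2 * (1 * (2 * q))"
      using sq pos by (intro mult_left_mono mult_mono) auto
    finally show ?thesis using KK by simp
  qed
  have w2: "(N + 1) * (N + 2) * w\<^sup>2 \<le> 8 * ((K + 2)\<^sup>2 * Y\<^sup>2 * q)"
  proof -
    have "(N + 1) * (N + 2) * w * w \<le> 2 * (K + 2)\<^sup>2 * Y\<^sup>2 * (4 * q)"
      using ws sq pos by (intro mult_mono[OF w]) auto
    then show ?thesis by (simp add: power2_eq_square[of w])
  qed
  have "(8 * u - 6 * v + w)\<^sup>2 \<le> 192 * u\<^sup>2 + 108 * v\<^sup>2 + 3 * w\<^sup>2"
  proof -
    \<comment> \<open>This is \<open>(x + y + z)\<^sup>2 \<le> 3 * (x\<^sup>2 + y\<^sup>2 + z\<^sup>2)\<close>, whose defect is a sum of squares.\<close>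
    have "192 * u\<^sup>2 + 108 * v\<^sup>2 + 3 * w\<^sup>2 - (8 * u - 6 * v + w)\<^sup>2 =
        (8 * u + 6 * v)\<^sup>2 + (6 * v + w)\<^sup>2 + (8 * u - w)\<^sup>2"
      by (simp add: power2_eq_square algebra_simps)
    moreover have "0 \<le> (8 * u + 6 * v)\<^sup>2 + (6 * v + w)\<^sup>2 + (8 * u - w)\<^sup>2" by simp
    ultimately show ?thesis by linarith
  qed
  then have "(N + 1) * (N + 2) * (8 * u - 6 * v + w)\<^sup>2 \<le>
      (N + 1) * (N + 2) * (192 * u\<^sup>2 + 108 * v\<^sup>2 + 3 * w\<^sup>2)"
    using N by (intro mult_left_mono) auto
  also have "\<dots> = 192 * ((N + 1) * (N + 2) * u\<^sup>2) + 108 * ((N + 1) * (N + 2) * v\<^sup>2) + 3 * ((N + 1) * (N + 2) * w\<^sup>2)"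
    by (simp add: algebra_simps)
  also have "\<dots> \<le> 156 * ((K + 2)\<^sup>2 * Y\<^sup>2 * q)"
    using u2 v2 w2 by linarith
  finally have main: "(N + 1) * (N + 2) * (8 * u - 6 * v + w)\<^sup>2 \<le> 156 * ((K + 2)\<^sup>2 * Y\<^sup>2 * q)" .
  have diff: "mean_profile (n + 2) k - 2 * mean_profile (n + 1) k + mean_profile n k = (8 * u - 6 * v + w) / Y"
    unfolding u_def v_def w_def Y_def k by (rule mean_profile_second_difference)
  have mean: "mean_profile (n + 2) k = Y * q"
    by (simp add: q_def Y_def k path_prob_def)
  have "(N + 1) * (N + 2) * ((8 * u - 6 * v + w) / Y)\<^sup>2 =
      (N + 1) * (N + 2) * (8 * u - 6 * v + w)\<^sup>2 / Y\<^sup>2"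
    by (simp add: power_divide)
  also have "\<dots> \<le> 156 * ((K + 2)\<^sup>2 * Y\<^sup>2 * q) / Y\<^sup>2"
    using main by (intro divide_right_mono) auto
  also have "\<dots> = 156 * (K + 2)\<^sup>2 / Y * (Y * q)"
    using Y by (simp add: field_simps power2_eq_square)
  finally show ?thesis
    unfolding diff unfolding mean by (simp only: N_def K_def Y_def)
qed

section \<open>The variance is at most of the order of the mean\<close>

lemma split_variance_mean_profile_le:
  assumes "2 \<le> k"
  shows "split_variance n (\<lambda>i j. mean_profile i k + mean_profile j k) \<le>
    78 * (real k + 2)\<^sup>2 / 2 ^ k * mean_profile (Suc n) (Suc k)"
proof -
  have "split_variance n (\<lambda>i j. mean_profile i k + mean_profile j k) \<le>
      156 * (real k + 2)\<^sup>2 / 2 ^ k * split_average n (\<lambda>i j. mean_profile i k)"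
    using mean_profile_second_difference_le[OF assms]
    by (intro split_variance_symmetric_le mean_profile_nonneg) auto
  then show ?thesis
    by (simp add: mean_profile_Suc_Suc split_average_fst_plus_snd)
qed

text \<open>The tolls add up to a convergent series: with \<open>q k = 2 * k\<^sup>2 + 12 * k + 22\<close> one has
  \<open>q k / 2 ^ k - q (k + 1) / 2 ^ (k + 1) = (k + 2)\<^sup>2 / 2 ^ k\<close>, so \<open>78 * q k / 2 ^ k\<close> is the
  room needed for the tolls of all later levels. At level 2 the constant equals
  \<open>1057 - 1053 = 4\<close>, a trivial bound, since there are at most 4 nodes on that level.\<close>

lemma var_profile_le_telescope:
  assumes "2 \<le> k"
  shows "var_profile n k \<le>
    (1057 - 78 * (2 * (real k)\<^sup>2 + 12 * real k + 22) / 2 ^ k) * mean_profile n k"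
  using assms
proof (induction k arbitrary: n rule: dec_induct)
  case base
  show ?case using var_profile_le_power_mult_mean[of n 2] by simp
next
  case (step k)
  let ?C = "\<lambda>k. 1057 - 78 * (2 * (real k)\<^sup>2 + 12 * real k + 22) / 2 ^ k"
  show ?case
  proof (cases n)
    case 0
    then show ?thesis by (simp add: var_profile_0 mean_profile_0)
  next
    case (Suc m)
    have "split_average m (\<lambda>i j. var_profile i k + var_profile j k) \<le>
        split_average m (\<lambda>i j. ?C k * (mean_profile i k + mean_profile j k))"
      using step.IH by (intro split_average_mono) (simp add: distrib_left add_mono)
    also have "\<dots> = ?C k * mean_profile n (Suc k)"
      by (simp only: split_average_cmult Suc mean_profile_Suc_Suc)
    finally have "var_profile n (Suc k) \<le>
        (?C k + 78 * (real k + 2)\<^sup>2 / 2 ^ k) * mean_profile n (Suc k)"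
      using split_variance_mean_profile_le[OF step.hyps(1), of m]
      by (simp add: Suc var_profile_Suc_Suc distrib_right)
    also have "?C k + 78 * (real k + 2)\<^sup>2 / 2 ^ k = ?C (Suc k)"
      by (simp add: field_simps power2_eq_square)
    finally show ?thesis .
  qed
qed

lemma var_profile_le: "var_profile n k \<le> 1057 * mean_profile n k"
proof (cases "2 \<le> k")
  case True
  have "var_profile n k \<le>
    (1057 - 78 * (2 * (real k)\<^sup>2 + 12 * real k + 22) / 2 ^ k) * mean_profile n k"
    by (rule var_profile_le_telescope[OF True])
  also have "\<dots> \<le> 1057 * mean_profile n k"
    by (intro mult_right_mono mean_profile_nonneg) simp
  finally show ?thesis .
next
  case False
  have "var_profile n k \<le> 2 ^ k * mean_profile n k"
    by (rule var_profile_le_power_mult_mean)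
  also have "\<dots> \<le> 1057 * mean_profile n k"
  proof (intro mult_right_mono mean_profile_nonneg)
    have "k = 0 \<or> k = 1" using False by auto
    then show "(2::real) ^ k \<le> 1057" by auto
  qed
  finally show ?thesis .
qed

section \<open>The mean is at most of the order of the variance\<close>

lemma mean_profile_low:
  "mean_profile (Suc 0) (Suc 0) = 2"
  "mean_profile (Suc (Suc 0)) (Suc 0) = 1"
  "mean_profile (Suc 0) (Suc (Suc 0)) = 0"
  "mean_profile (Suc (Suc 0)) (Suc (Suc 0)) = 2"
  by (simp_all add: mean_profile_Suc_Suc mean_profile_0 mean_profile_Suc_0)

lemma split_variance_le_var_profile:
  "split_variance n (\<lambda>i j. mean_profile i k + mean_profile j k) \<le> var_profile (Suc n) (Suc k)"
  by (simp add: var_profile_Suc_Suc split_average_nonneg var_profile_nonneg)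

text \<open>The profile is nondegenerate in two small cases, shown by the toll at the root alone. They
  start the lower bound, which fails at levels up to 2 (a tree of size 2 always has two
  external nodes at level 2).\<close>

lemma var_profile_3_2: "1 \<le> var_profile 3 2"
proof -
  have "1 \<le> split_variance 2 (\<lambda>i j. mean_profile i 1 + mean_profile j 1)"
    by (simp add: split_variance_def numeral_2_eq_2 mean_profile_low mean_profile_0 power_divide)
  also have "\<dots> \<le> var_profile 3 2"
    using split_variance_le_var_profile[of 2 1] by (simp add: numeral_3_eq_3 numeral_2_eq_2)
  finally show ?thesis .
qed

lemma var_profile_3_3: "1 \<le> var_profile 3 3"
proof -
  have "1 \<le> split_variance 2 (\<lambda>i j. mean_profile i 2 + mean_profile j 2)"
    by (simp add: split_variance_def numeral_2_eq_2 mean_profile_low mean_profile_0 power_divide)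
  also have "\<dots> \<le> var_profile 3 3"
    using split_variance_le_var_profile[of 2 2] by (simp add: numeral_3_eq_3 numeral_2_eq_2)
  finally show ?thesis .
qed

lemma mean_profile_eq_0: "n < k \<Longrightarrow> mean_profile n k = 0"
proof (induction n arbitrary: k)
  case 0
  then show ?case by (simp add: mean_profile_0)
next
  case (Suc n)
  then show ?case
    by (cases k) (simp_all add: mean_profile_Suc_left)
qed

text \<open>At level 3 the tree sizes from 3 to 511 have a variance bounded away from 0, because with
  positive probability the left subtree has size 3 and then varies at its level 2 (size 3
  itself is treated separately). The exponent 514 comes from \<open>1 / 2 ^ 511\<close>, a lower bound for
  the variance of these trees, and from the upper bound \<open>2 ^ 3\<close> for the mean. For larger trees
  the mean is at most \<open>1 / 2\<close>, and integrality of the profile suffices.\<close>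

lemma var_profile_3_ge: "1 / 2 ^ 514 * mean_profile n 3 \<le> var_profile n 3"
proof -
  consider "n < 3" | "3 \<le> n" "n \<le> 511" | "511 < n" by linarith
  then show ?thesis
  proof cases
    case 1
    then show ?thesis by (simp add: mean_profile_eq_0 var_profile_nonneg)
  next
    case 2
    have "1 / 2 ^ 511 \<le> var_profile n 3"
    proof (cases "n = 3")
      case True
      have "(1 :: real) / 2 ^ 511 \<le> 1" by simp
      also have "1 \<le> var_profile n 3" using True var_profile_3_3 by simp
      finally show ?thesis .
    next
      case False
      then obtain m where m: "n = Suc m" "3 \<le> m" "m \<le> 511"
        using 2 by (cases n) auto
      have "(1 :: real) / 2 ^ 511 \<le> 1 / 2 ^ m"
        using m(3) by (intro divide_left_mono power_increasing) auto
      also have "\<dots> \<le> var_profile 3 2 / 2 ^ m"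
        using var_profile_3_2 by (intro divide_right_mono) auto
      also have "\<dots> \<le> split_average m (\<lambda>i j. var_profile i 2)"
        by (intro split_average_ge_point var_profile_nonneg m)
      also have "\<dots> \<le> split_average m (\<lambda>i j. var_profile i 2 + var_profile j 2)"
        by (intro split_average_mono) (simp add: var_profile_nonneg)
      also have "\<dots> \<le> var_profile n 3"
        using var_profile_Suc_Suc[of m 2] m(1)
          split_variance_nonneg[of m "\<lambda>i j. mean_profile i 2 + mean_profile j 2"]
        by (simp add: numeral_3_eq_3 numeral_2_eq_2)
      finally show ?thesis .
    qed
    moreover have "1 / 2 ^ 514 * mean_profile n 3 \<le> 1 / 2 ^ 514 * 2 ^ 3"
      by (intro mult_left_mono mean_profile_le) simp
    moreover have "1 / 2 ^ 514 * 2 ^ 3 = (1 / 2 ^ 511 :: real)" by simp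
    ultimately show ?thesis by linarith
  next
    case 3
    \<comment> \<open>Moving one level down bounds the mean by a multiple of \<open>1 / n\<close>.\<close>
    have "(real n + 1) * path_prob n 3 \<le> 32 * path_prob (Suc n) (Suc 3)"
      using path_prob_le_descend[of n 3] by simp
    also have "\<dots> \<le> 32"
      using path_prob_le_1[of "Suc n" "Suc 3"] by simp
    finally have "512 * path_prob n 3 \<le> 32"
      using 3 mult_right_mono[of 512 "real n + 1" "path_prob n 3"] path_prob_nonneg[of n 3] by simp
    then have half: "mean_profile n 3 \<le> 1 / 2" by (simp add: path_prob_def)
    have "1 / 2 ^ 514 * mean_profile n 3 \<le> (1 - mean_profile n 3) * mean_profile n 3"
    proof (intro mult_right_mono mean_profile_nonneg)
      have "(1 :: real) / 2 ^ 514 \<le> 1 / 2" by simp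
      with half show "1 / 2 ^ 514 \<le> 1 - mean_profile n 3" by linarith
    qed
    also have "\<dots> \<le> var_profile n 3"
      using mean_mult_one_minus_mean_le_var_profile[of n 3] by (simp only: mult.commute)
    finally show ?thesis .
  qed
qed

text \<open>The bound passes from one level to the next by dropping the nonnegative toll.\<close>

lemma var_profile_ge:
  assumes "3 \<le> k"
  shows "1 / 2 ^ 514 * mean_profile n k \<le> var_profile n k"
  using assms
proof (induction k arbitrary: n rule: dec_induct)
  case base
  show ?case by (rule var_profile_3_ge)
next
  case (step k)
  show ?case
  proof (cases n)
    case 0
    then show ?thesis by (simp add: var_profile_0 mean_profile_0)
  next
    case (Suc m)
    have "1 / 2 ^ 514 * mean_profile n (Suc k) =
      split_average m (\<lambda>i j. 1 / 2 ^ 514 * (mean_profile i k + mean_profile j k))"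
      by (simp only: split_average_cmult Suc mean_profile_Suc_Suc)
    also have "\<dots> \<le> split_average m (\<lambda>i j. var_profile i k + var_profile j k)"
      using step.IH by (intro split_average_mono) (simp only: distrib_left add_mono)
    also have "\<dots> \<le> var_profile n (Suc k)"
      by (simp add: Suc var_profile_Suc_Suc split_variance_nonneg)
    finally show ?thesis .
  qed
qed

section \<open>Equivalence of the two orders of magnitude\<close>

theorem corollary1:
  "(\<forall>k :: nat \<Rightarrow> nat. (\<forall>\<^sub>F n in sequentially. k n \<le> n) \<longrightarrow>
      (filterlim (\<lambda>n. mean_profile n (k n)) at_top sequentially \<longleftrightarrow>
       filterlim (\<lambda>n. var_profile n (k n)) at_top sequentially)) \<and>
   (\<exists>c C :: real. 0 < c \<and> 0 < C \<and>
      (\<forall>k :: nat \<Rightarrow> nat. (\<forall>\<^sub>F n in sequentially. k n \<le> n) \<longrightarrow>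
         filterlim (\<lambda>n. mean_profile n (k n)) at_top sequentially \<longrightarrow>
         (\<forall>\<^sub>F n in sequentially.
            c \<le> mean_profile n (k n) / var_profile n (k n) \<and>
            mean_profile n (k n) / var_profile n (k n) \<le> C)))"
proof -
  have large: "0 < mean_profile n j \<and> mean_profile n j \<le> 2 ^ 514 * var_profile n j"
    if "4 < mean_profile n j" for n j
  proof -
    \<comment> \<open>At most 4 external nodes lie on a level up to 2.\<close>
    have "3 \<le> j"
    proof (rule ccontr)
      assume "\<not> 3 \<le> j"
      then have "(2 :: real) ^ j \<le> 2 ^ 2" by (intro power_increasing) auto
      with that mean_profile_le[of n j] show False by simp
    qed
    from var_profile_ge[OF this, of n] that show ?thesis by (simp add: field_simps)
  qed
  have ev: "\<forall>\<^sub>F n in sequentially. 0 < mean_profile n (k n) \<and>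
      mean_profile n (k n) \<le> 2 ^ 514 * var_profile n (k n)"
    if "filterlim (\<lambda>n. mean_profile n (k n)) at_top sequentially" for k
    using that[unfolded filterlim_at_top_dense, rule_format, of 4]
    by (rule eventually_mono) (rule large)
  have "filterlim (\<lambda>n. mean_profile n (k n)) at_top sequentially \<longleftrightarrow>
      filterlim (\<lambda>n. var_profile n (k n)) at_top sequentially" for k
  proof
    assume lim: "filterlim (\<lambda>n. mean_profile n (k n)) at_top sequentially"
    have "filterlim (\<lambda>n. 1 / 2 ^ 514 * mean_profile n (k n)) at_top sequentially"
      by (rule filterlim_tendsto_pos_mult_at_top[OF tendsto_const _ lim]) simp
    then show "filterlim (\<lambda>n. var_profile n (k n)) at_top sequentially"
      by (rule filterlim_at_top_mono) (use ev[OF lim] in \<open>eventually_elim, simp\<close>)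
  next
    assume lim: "filterlim (\<lambda>n. var_profile n (k n)) at_top sequentially"
    have scaled: "1 / 1057 * var_profile n j \<le> mean_profile n j" for n j
      using var_profile_le[of n j] by simp
    have "filterlim (\<lambda>n. 1 / 1057 * var_profile n (k n)) at_top sequentially"
      by (rule filterlim_tendsto_pos_mult_at_top[OF tendsto_const _ lim]) simp
    then show "filterlim (\<lambda>n. mean_profile n (k n)) at_top sequentially"
      by (rule filterlim_at_top_mono) (intro always_eventually allI scaled)
  qed
  moreover have "\<forall>\<^sub>F n in sequentially. 1 / 1057 \<le> mean_profile n (k n) / var_profile n (k n) \<and>
      mean_profile n (k n) / var_profile n (k n) \<le> 2 ^ 514"
    if "filterlim (\<lambda>n. mean_profile n (k n)) at_top sequentially" for k
    using ev[OF that]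
  proof eventually_elim
    case (elim n)
    then have "0 < 2 ^ 514 * var_profile n (k n)" by linarith
    then have "0 < var_profile n (k n)" by (simp add: zero_less_mult_iff)
    then show ?case
      using elim var_profile_le[of n "k n"] by (simp add: field_simps)
  qed
  ultimately show ?thesis
    by (intro conjI exI[of _ "1 / 1057"] exI[of _ "2 ^ 514"]) auto
qed

end
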